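(* Let $f:\mathbb R\to\mathbb R$ be smooth with $f_{uu}=\beta f$ for a real constant $\beta\ne0$. Define recursively, for integers $i,l,m\ge1$, $$P^1=u_0,$$ $$\phi^i=\begin{cases}(P^l)^2+2\sum_{j=1}^{l-1}\theta^{j,i-j}&\text{if } i=2l-1,\\ P^{l+1}P^l+\theta^{l,l}+2\sum_{j=1}^{l-1}\theta^{j,i-j}&\text{if } i=2l,\end{cases}$$ $$\theta^{l,m}=P^lP^{m+1}-e_{-1}(P^l)\,e_{-1}(P^m)+\tfrac\beta4\phi^l\phi^m,\qquad P^{i+1}=e_{-1}e_{-1}P^i-\tfrac\beta2u_0\phi^i.$$ Then for all $i\ge1$ $$e_{-1}\phi^i=2u_0\,e_{-1}P^i,\qquad e_{\overline{-1}}\phi^i=-2fP^i,$$ and $$e_{\overline{-1}}e_{-1}P^i=-f_uP^i,$$ so $P^i\in V_{2i-1}$.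
   Context: Subscripts such as $f_u$, $P_{u_i}$ denote partial derivatives; bars denote complex conjugation. The functions live on the infinite jet space $M^{(\infty)}$ with complex coordinates $z,u_0,u_1,u_2,\dots$ and real coordinate $u$ (each smooth function depends on finitely many coordinates). Put $T^0=f(u)$, $T^{i+1}=\sum_{j=0}^{i}\binom ij u_{i-j}\,T^j_u$, and $e_{-1}=\partial_z+u_0\partial_u+\sum_{i\ge0}u_{i+1}\partial_{u_i}-\sum_{i\ge0}\overline{T^i}\,\partial_{\bar u_i}$, $e_{\overline{-1}}=\overline{e_{-1}}$. A complex function $P$ has weighted degree $d\in\mathbb Z$ if $P(u,\lambda^{-1}z,(\lambda^{j+1}u_j)_j)=\lambda^dP(u,z,(u_j)_j)$ for all $\lambda\in\mathbb C$ with $|\lambda|=1$. $V_d$ is the complex vector space of complex-valued functions $P$ on $M^{(\infty)}$ of weighted degree $d$ satisfying $e_{\overline{-1}}e_{-1}P+f_uP=0$, $P_u=0$ and $P_{u_i\bar u_j}=0$ for all $i,j\ge0$. *)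

theory Defs
  imports "HOL-Analysis.Analysis"
begin

section \<open>The infinite jet space and its coordinate derivatives\<close>

text \<open>A point is the triple of its coordinates \<open>z\<close>, \<open>u\<close> and \<open>(u\<^sub>0, u\<^sub>1, \<dots>)\<close>.\<close>

type_synonym jet = "complex \<times> real \<times> (nat \<Rightarrow> complex)"

definition ucoord :: "jet \<Rightarrow> real" where
  "ucoord p = fst (snd p)"

definition jcoord :: "nat \<Rightarrow> jet \<Rightarrow> complex" where
  "jcoord i p = snd (snd p) i"

text \<open>The real coordinates are the real and imaginary parts of \<open>z\<close>, the coordinate \<open>u\<close>, and
  the real and imaginary parts of the \<open>u\<^sub>i\<close>; \<open>move c t p\<close> adds \<open>t\<close> to the real coordinate \<open>c\<close>.\<close>

datatype coord = ReZ | ImZ | U | ReJ nat | ImJ nat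

fun move :: "coord \<Rightarrow> real \<Rightarrow> jet \<Rightarrow> jet" where
  "move ReZ t (z, u, w) = (z + of_real t, u, w)"
| "move ImZ t (z, u, w) = (z + \<i> * of_real t, u, w)"
| "move U t (z, u, w) = (z, u + t, w)"
| "move (ReJ i) t (z, u, w) = (z, u, w(i := w i + of_real t))"
| "move (ImJ i) t (z, u, w) = (z, u, w(i := w i + \<i> * of_real t))"

definition pd :: "coord \<Rightarrow> (jet \<Rightarrow> complex) \<Rightarrow> jet \<Rightarrow> complex" where
  "pd c P p = vector_derivative (\<lambda>t. P (move c t p)) (at 0)"

definition d_z :: "(jet \<Rightarrow> complex) \<Rightarrow> jet \<Rightarrow> complex" where
  "d_z P p = (pd ReZ P p - \<i> * pd ImZ P p) / 2"

definition d_u :: "(jet \<Rightarrow> complex) \<Rightarrow> jet \<Rightarrow> complex" where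
  "d_u P p = pd U P p"

definition d_j :: "nat \<Rightarrow> (jet \<Rightarrow> complex) \<Rightarrow> jet \<Rightarrow> complex" where
  "d_j i P p = (pd (ReJ i) P p - \<i> * pd (ImJ i) P p) / 2"

definition d_jbar :: "nat \<Rightarrow> (jet \<Rightarrow> complex) \<Rightarrow> jet \<Rightarrow> complex" where
  "d_jbar i P p = (pd (ReJ i) P p + \<i> * pd (ImJ i) P p) / 2"

text \<open>Smoothness: \<open>P\<close> depends on finitely many coordinates only, and all its iterated real partial
  derivatives exist and are continuous. For functions of finitely many coordinates, continuity in
  the product topology is continuity in these coordinates.\<close>

definition finitely_many_coords :: "(jet \<Rightarrow> complex) \<Rightarrow> bool" where
  "finitely_many_coords P \<longleftrightarrow>
     (\<exists>n. \<forall>z u w w'. (\<forall>i<n. w i = w' i) \<longrightarrow> P (z, u, w) = P (z, u, w'))"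

definition jet_smooth :: "(jet \<Rightarrow> complex) \<Rightarrow> bool" where
  "jet_smooth P \<longleftrightarrow> finitely_many_coords P \<and>
     (\<forall>cs. continuous_on UNIV (foldr pd cs P) \<and>
        (\<forall>c p. (\<lambda>t. foldr pd cs P (move c t p)) differentiable (at 0)))"


section \<open>The vector field $e_{-1}$ and its conjugate\<close>

fun T :: "(real \<Rightarrow> real) \<Rightarrow> nat \<Rightarrow> jet \<Rightarrow> complex" where
  "T f 0 = (\<lambda>p. of_real (f (ucoord p)))"
| "T f (Suc i) =
     (\<lambda>p. \<Sum>j\<in>{0..i}. of_nat (i choose j) * jcoord (i - j) p * d_u (T f j) p)"

text \<open>On functions of finitely many coordinates only finitely many terms of the two series are
  nonzero.\<close>

definition e_m1 :: "(real \<Rightarrow> real) \<Rightarrow> (jet \<Rightarrow> complex) \<Rightarrow> jet \<Rightarrow> complex" where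
  "e_m1 f P p = d_z P p + jcoord 0 p * d_u P p
     + (\<Sum>i. jcoord (Suc i) p * d_j i P p) - (\<Sum>i. cnj (T f i p) * d_jbar i P p)"

text \<open>The conjugate of a complex vector field \<open>X\<close> acts by \<open>P \<mapsto> cnj (X (cnj P))\<close>.\<close>

definition e_m1_bar :: "(real \<Rightarrow> real) \<Rightarrow> (jet \<Rightarrow> complex) \<Rightarrow> jet \<Rightarrow> complex" where
  "e_m1_bar f P p = cnj (e_m1 f (\<lambda>q. cnj (P q)) p)"


section \<open>Weighted degree and the spaces $V_d$\<close>

definition weighted_degree :: "(jet \<Rightarrow> complex) \<Rightarrow> int \<Rightarrow> bool" where
  "weighted_degree P d \<longleftrightarrow>
     (\<forall>l::complex. norm l = 1 \<longrightarrow>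
        (\<forall>z u w. P (inverse l * z, u, \<lambda>j. l ^ (j + 1) * w j) = l powi d * P (z, u, w)))"

definition V :: "(real \<Rightarrow> real) \<Rightarrow> int \<Rightarrow> (jet \<Rightarrow> complex) set" where
  "V f d = {P. jet_smooth P \<and> weighted_degree P d \<and>
     (\<forall>p. e_m1_bar f (e_m1 f P) p + of_real (deriv f (ucoord p)) * P p = 0) \<and>
     (\<forall>p. d_u P p = 0) \<and>
     (\<forall>i j p. d_jbar j (d_j i P) p = 0)}"


section \<open>The recursion\<close>

text \<open>The indices of \<open>P\<close>, \<open>\<phi>\<close>, \<open>\<theta>\<close> start at 1; values at index 0 are dummies and are never used.
  The defining equations in their usual form are derived below.\<close>

function Pseq :: "(real \<Rightarrow> real) \<Rightarrow> real \<Rightarrow> nat \<Rightarrow> jet \<Rightarrow> complex"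
  and phi :: "(real \<Rightarrow> real) \<Rightarrow> real \<Rightarrow> nat \<Rightarrow> jet \<Rightarrow> complex"
  and theta :: "(real \<Rightarrow> real) \<Rightarrow> real \<Rightarrow> nat \<Rightarrow> nat \<Rightarrow> jet \<Rightarrow> complex"
where
  "Pseq f \<beta> i =
     (if i = 0 then (\<lambda>p. 0)
      else if i = 1 then (\<lambda>p. jcoord 0 p)
      else (\<lambda>p. e_m1 f (e_m1 f (Pseq f \<beta> (i - 1))) p
                  - of_real \<beta> / 2 * jcoord 0 p * phi f \<beta> (i - 1) p))"
| "phi f \<beta> i =
     (if i = 0 then (\<lambda>p. 0)
      else if odd i then
        (\<lambda>p. (Pseq f \<beta> ((i + 1) div 2) p)\<^sup>2
              + 2 * (\<Sum>j\<in>{1..<(i + 1) div 2}. theta f \<beta> j (i - j) p))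
      else
        (\<lambda>p. Pseq f \<beta> (i div 2 + 1) p * Pseq f \<beta> (i div 2) p
              + theta f \<beta> (i div 2) (i div 2) p
              + 2 * (\<Sum>j\<in>{1..<i div 2}. theta f \<beta> j (i - j) p)))"
| "theta f \<beta> l m =
     (if l = 0 \<or> m = 0 then (\<lambda>p. 0)
      else (\<lambda>p. Pseq f \<beta> l p * Pseq f \<beta> (m + 1) p
                  - e_m1 f (Pseq f \<beta> l) p * e_m1 f (Pseq f \<beta> m) p
                  + of_real \<beta> / 4 * phi f \<beta> l p * phi f \<beta> m p))"
  by pat_completeness auto
termination
  by (relation "Wellfounded.measure (case_sum (\<lambda>(f, \<beta>, i). 3 * i)
        (case_sum (\<lambda>(f, \<beta>, i). 3 * i + 2) (\<lambda>(f, \<beta>, l, m). 3 * (l + m) + 1)))")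
    (auto elim!: oddE evenE)

declare Pseq.simps [simp del] phi.simps [simp del] theta.simps [simp del]

lemma Pseq_1: "Pseq f \<beta> 1 = (\<lambda>p. jcoord 0 p)"
  by (subst Pseq.simps) simp

lemma Pseq_Suc:
  assumes "i \<ge> 1"
  shows "Pseq f \<beta> (i + 1) =
    (\<lambda>p. e_m1 f (e_m1 f (Pseq f \<beta> i)) p - of_real \<beta> / 2 * jcoord 0 p * phi f \<beta> i p)"
  using assms by (subst Pseq.simps) simp

lemma phi_odd:
  assumes "l \<ge> 1" and "i = 2 * l - 1"
  shows "phi f \<beta> i =
    (\<lambda>p. (Pseq f \<beta> l p)\<^sup>2 + 2 * (\<Sum>j\<in>{1..l - 1}. theta f \<beta> j (i - j) p))"
proof -
  have "odd i" "i \<noteq> 0" "(i + 1) div 2 = l" "{1..<l} = {1..l - 1}"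
    using assms by auto
  then show ?thesis
    by (subst phi.simps) simp
qed

lemma phi_even:
  assumes "l \<ge> 1" and "i = 2 * l"
  shows "phi f \<beta> i =
    (\<lambda>p. Pseq f \<beta> (l + 1) p * Pseq f \<beta> l p + theta f \<beta> l l p
          + 2 * (\<Sum>j\<in>{1..l - 1}. theta f \<beta> j (i - j) p))"
proof -
  have "even i" "i \<noteq> 0" "i div 2 = l" "{1..<l} = {1..l - 1}"
    using assms by auto
  then show ?thesis
    by (subst phi.simps) simp
qed

lemma theta_eq:
  assumes "l \<ge> 1" and "m \<ge> 1"
  shows "theta f \<beta> l m =
    (\<lambda>p. Pseq f \<beta> l p * Pseq f \<beta> (m + 1) p - e_m1 f (Pseq f \<beta> l) p * e_m1 f (Pseq f \<beta> m) p
          + of_real \<beta> / 4 * phi f \<beta> l p * phi f \<beta> m p)"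
  using assms by (subst theta.simps) simp

end

theory Submission
  imports Defs
begin

text \<open>All \<open>P\<^sup>i\<close> and \<open>\<phi>\<^sup>i\<close> are weighted homogeneous polynomials in the \<open>u\<^sub>j\<close>. On such
  polynomials the vector field \<open>D = e\<^sub>-\<^sub>1\<close> and its conjugate \<open>E\<close> commute, because \<open>D T\<^sup>i = T\<^sup>i\<^sup>+\<^sup>1\<close>.
  Hence the three identities for \<open>P\<^sup>i\<close>, \<open>\<phi>\<^sup>i\<close> give
  \<open>E P\<^sup>i\<^sup>+\<^sup>1 = (\<beta>/2) f \<phi>\<^sup>i - f\<^sub>u D P\<^sup>i\<close> and, applying \<open>D\<close>, \<open>E D P\<^sup>i\<^sup>+\<^sup>1 = - f\<^sub>u P\<^sup>i\<^sup>+\<^sup>1\<close>. They also give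
  \<open>D \<theta>\<^sup>l\<^sup>,\<^sup>m = P\<^sup>l D P\<^sup>m\<^sup>+\<^sup>1 - P\<^sup>l\<^sup>+\<^sup>1 D P\<^sup>m\<close> and \<open>E \<theta>\<^sup>l\<^sup>,\<^sup>m = E P\<^sup>l P\<^sup>m\<^sup>+\<^sup>1 - E P\<^sup>l\<^sup>+\<^sup>1 P\<^sup>m\<close>, so the sums
  over \<open>\<theta>\<^sup>j\<^sup>,\<^sup>i\<^sup>-\<^sup>j\<close> in \<open>D \<phi>\<^sup>i\<close> and \<open>E \<phi>\<^sup>i\<close> telescope to \<open>2 P\<^sup>1 D P\<^sup>i\<close> and \<open>2 (E P\<^sup>1) P\<^sup>i\<close>.\<close>

section \<open>Derivations on differentiable jet functions\<close>

text \<open>First-order weakening of \<open>jet_smooth\<close>: it is closed under ring operations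
  and conjugation, and it suffices for the product rule of \<open>e_m1\<close>. The dependence on
  finitely many coordinates is kept because it makes the two series in \<open>e_m1\<close>
  finite.\<close>

definition jet_diff :: "(jet \<Rightarrow> complex) \<Rightarrow> bool" where
  "jet_diff P \<longleftrightarrow> finitely_many_coords P \<and>
     (\<forall>c p. (\<lambda>t. P (move c t p)) differentiable (at 0))"

lemma move_0 [simp]: "move c 0 p = p"
  by (cases p; cases c) auto

lemma finitely_many_coords_map2:
  assumes "finitely_many_coords P" "finitely_many_coords Q"
  shows "finitely_many_coords (\<lambda>p. h (P p) (Q p))"
proof -
  obtain m where m: "\<And>z u w w'. (\<forall>i<m. w i = w' i) \<Longrightarrow> P (z, u, w) = P (z, u, w')"
    using assms(1) by (auto simp: finitely_many_coords_def)
  obtain n where n: "\<And>z u w w'. (\<forall>i<n. w i = w' i) \<Longrightarrow> Q (z, u, w) = Q (z, u, w')"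
    using assms(2) by (auto simp: finitely_many_coords_def)
  have "h (P (z, u, w)) (Q (z, u, w)) = h (P (z, u, w')) (Q (z, u, w'))"
    if "\<forall>i<max m n. w i = w' i" for z u w w'
    using m[of w w' z u] n[of w w' z u] that by simp
  then show ?thesis
    unfolding finitely_many_coords_def by blast
qed

lemma jet_diff_const [simp]: "jet_diff (\<lambda>p. c)"
  by (auto simp: jet_diff_def finitely_many_coords_def)

lemma jet_diff_add [simp]:
  "jet_diff P \<Longrightarrow> jet_diff Q \<Longrightarrow> jet_diff (\<lambda>p. P p + Q p)"
  by (auto simp: jet_diff_def intro: finitely_many_coords_map2)

lemma jet_diff_mult [simp]:
  "jet_diff P \<Longrightarrow> jet_diff Q \<Longrightarrow> jet_diff (\<lambda>p. P p * Q p)"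
  by (auto simp: jet_diff_def intro: finitely_many_coords_map2)

lemma jet_diff_sum [simp]:
  "(\<And>j. j \<in> A \<Longrightarrow> jet_diff (P j)) \<Longrightarrow> jet_diff (\<lambda>p. \<Sum>j\<in>A. P j p)"
  by (induction A rule: infinite_finite_induct) auto

lemma jet_diff_cnj [simp]:
  assumes "jet_diff P" shows "jet_diff (\<lambda>p. cnj (P p))"
proof -
  have "finitely_many_coords (\<lambda>p. cnj (P p))"
    using assms finitely_many_coords_map2[of P P "\<lambda>x y. cnj x"] by (simp add: jet_diff_def)
  moreover have "(\<lambda>t. cnj (P (move c t p))) differentiable (at 0)" for c p
  proof -
    have "(\<lambda>t. P (move c t p)) differentiable (at 0)"
      using assms unfolding jet_diff_def by blast
    from has_vector_derivative_cnj[OF this[unfolded vector_derivative_works]]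
    show ?thesis
      by (rule differentiableI_vector)
  qed
  ultimately show ?thesis
    by (simp add: jet_diff_def)
qed

lemma jcoord_move:
  "jcoord i (move c t p) = jcoord i p +
     (if c = ReJ i then of_real t else if c = ImJ i then \<i> * of_real t else 0)"
  by (cases p; cases c) (auto simp: jcoord_def)

lemma ucoord_move: "ucoord (move c t p) = ucoord p + (if c = U then t else 0)"
  by (cases p; cases c) (auto simp: ucoord_def)

lemma jcoord_has_vector_derivative:
  "((\<lambda>t. jcoord i (move c t p)) has_vector_derivative
      (if c = ReJ i then 1 else if c = ImJ i then \<i> else 0)) (at 0)"
  unfolding jcoord_move by (cases "c = ReJ i"; cases "c = ImJ i") (auto intro!: derivative_eq_intros)

lemma jet_diff_jcoord [simp]: "jet_diff (jcoord i)"
proof -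
  have "finitely_many_coords (jcoord i)"
    unfolding finitely_many_coords_def by (rule exI[of _ "Suc i"]) (auto simp: jcoord_def)
  then show ?thesis
    unfolding jet_diff_def using jcoord_has_vector_derivative by (blast intro: differentiableI_vector)
qed

lemma of_real_ucoord_has_vector_derivative:
  assumes "g differentiable (at (ucoord p))"
  shows "((\<lambda>t. complex_of_real (g (ucoord (move c t p)))) has_vector_derivative
           (if c = U then of_real (deriv g (ucoord p)) else 0)) (at 0)"
proof (cases "c = U")
  case True
  have "(g has_field_derivative deriv g (ucoord p)) (at (0 + ucoord p))"
    using assms by (simp add: DERIV_deriv_iff_real_differentiable)
  then have "((\<lambda>t. g (ucoord p + t)) has_field_derivative deriv g (ucoord p)) (at 0)"
    using DERIV_shift[of g "deriv g (ucoord p)" 0 "ucoord p"] by (simp add: add.commute)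
  from has_vector_derivative_of_real[OF this] show ?thesis
    using True by (simp add: ucoord_move)
qed (simp add: ucoord_move)

lemma jet_diff_ucoord:
  assumes "\<And>x. g differentiable (at x)"
  shows "jet_diff (\<lambda>p. complex_of_real (g (ucoord p)))"
  using of_real_ucoord_has_vector_derivative[OF assms]
  by (auto simp: jet_diff_def finitely_many_coords_def ucoord_def
      intro!: differentiableI_vector)

section \<open>Rules for the real coordinate derivatives\<close>

lemma pd_const [simp]: "pd c (\<lambda>p. k) = (\<lambda>p. 0)"
  by (simp add: pd_def fun_eq_iff)

lemma pd_add [simp]:
  "jet_diff P \<Longrightarrow> jet_diff Q \<Longrightarrow> pd c (\<lambda>p. P p + Q p) = (\<lambda>p. pd c P p + pd c Q p)"
  by (simp add: pd_def fun_eq_iff jet_diff_def)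

lemma pd_mult [simp]:
  "jet_diff P \<Longrightarrow> jet_diff Q \<Longrightarrow> pd c (\<lambda>p. P p * Q p) = (\<lambda>p. P p * pd c Q p + pd c P p * Q p)"
  by (simp add: pd_def fun_eq_iff jet_diff_def)

lemma pd_cnj [simp]:
  assumes "jet_diff P" shows "pd c (\<lambda>p. cnj (P p)) = (\<lambda>p. cnj (pd c P p))"
  unfolding pd_def using assms
  by (auto simp: jet_diff_def fun_eq_iff vector_derivative_works
      intro!: vector_derivative_at has_vector_derivative_cnj)

lemma pd_jcoord [simp]:
  "pd c (jcoord i) = (\<lambda>p. if c = ReJ i then 1 else if c = ImJ i then \<i> else 0)"
  unfolding pd_def by (intro ext vector_derivative_at jcoord_has_vector_derivative)

lemma pd_ucoord:
  assumes "\<And>x. g differentiable (at x)"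
  shows "pd c (\<lambda>p. complex_of_real (g (ucoord p))) =
    (\<lambda>p. if c = U then of_real (deriv g (ucoord p)) else 0)"
  unfolding pd_def
  using of_real_ucoord_has_vector_derivative[OF assms] by (auto intro!: vector_derivative_at)

text \<open>Moving a coordinate of index beyond those on which \<open>P\<close> depends leaves
  \<open>P\<close> fixed. Hence both series in \<open>e_m1\<close> are finite sums, which justifies
  the termwise manipulations of \<open>suminf\<close> below.\<close>

lemma eventually_pd_zero:
  assumes "jet_diff P"
  shows "\<exists>n. \<forall>i\<ge>n. \<forall>p. pd (ReJ i) P p = 0 \<and> pd (ImJ i) P p = 0"
proof -
  obtain n where n: "\<And>z u w w'. (\<forall>i<n. w i = w' i) \<Longrightarrow> P (z, u, w) = P (z, u, w')"
    using assms by (auto simp: jet_diff_def finitely_many_coords_def)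
  have "P (move c t p) = P p" if "i \<ge> n" "c = ReJ i \<or> c = ImJ i" for i c t p
    using that by (cases p) (auto intro!: n)
  then have "\<forall>i\<ge>n. \<forall>p. pd (ReJ i) P p = 0 \<and> pd (ImJ i) P p = 0"
    by (simp add: pd_def)
  then show ?thesis ..
qed

lemma summable_d_j:
  assumes "jet_diff P" shows "summable (\<lambda>i. a i * d_j i P p)"
proof -
  obtain n where "\<forall>i\<ge>n. \<forall>p. pd (ReJ i) P p = 0 \<and> pd (ImJ i) P p = 0"
    using eventually_pd_zero[OF assms] by blast
  then show ?thesis
    by (intro summable_finite[of "{..<n}"]) (auto simp: d_j_def not_less simp del: split_paired_All)
qed

lemma summable_d_jbar:
  assumes "jet_diff P" shows "summable (\<lambda>i. a i * d_jbar i P p)"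
proof -
  obtain n where "\<forall>i\<ge>n. \<forall>p. pd (ReJ i) P p = 0 \<and> pd (ImJ i) P p = 0"
    using eventually_pd_zero[OF assms] by blast
  then show ?thesis
    by (intro summable_finite[of "{..<n}"]) (auto simp: d_jbar_def not_less simp del: split_paired_All)
qed

section \<open>The vector field and its conjugate as derivations\<close>

lemma e_m1_const [simp]: "e_m1 f (\<lambda>p. c) = (\<lambda>p. 0)"
  by (simp add: e_m1_def fun_eq_iff d_z_def d_u_def d_j_def d_jbar_def)

lemma e_m1_add [simp]:
  assumes "jet_diff P" "jet_diff Q"
  shows "e_m1 f (\<lambda>p. P p + Q p) = (\<lambda>p. e_m1 f P p + e_m1 f Q p)"
proof
  fix p
  have 1: "a * d_j i (\<lambda>p. P p + Q p) p = a * d_j i P p + a * d_j i Q p" for i a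
    using assms by (simp add: d_j_def field_simps)
  have 2: "a * d_jbar i (\<lambda>p. P p + Q p) p = a * d_jbar i P p + a * d_jbar i Q p" for i a
    using assms by (simp add: d_jbar_def field_simps)
  show "e_m1 f (\<lambda>p. P p + Q p) p = e_m1 f P p + e_m1 f Q p"
    using assms unfolding e_m1_def 1 2
    by (simp add: d_z_def d_u_def suminf_add[symmetric] summable_d_j summable_d_jbar)
       (simp add: field_simps)
qed

lemma e_m1_mult [simp]:
  assumes "jet_diff P" "jet_diff Q"
  shows "e_m1 f (\<lambda>p. P p * Q p) = (\<lambda>p. e_m1 f P p * Q p + P p * e_m1 f Q p)"
proof
  fix p
  have 1: "a * d_j i (\<lambda>p. P p * Q p) p = Q p * (a * d_j i P p) + P p * (a * d_j i Q p)" for i a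
    using assms by (simp add: d_j_def field_simps)
  have 2: "a * d_jbar i (\<lambda>p. P p * Q p) p = Q p * (a * d_jbar i P p) + P p * (a * d_jbar i Q p)"
    for i a
    using assms by (simp add: d_jbar_def field_simps)
  have 3: "(\<Sum>i. Q p * (a i * d_j i P p) + P p * (a i * d_j i Q p)) =
      Q p * (\<Sum>i. a i * d_j i P p) + P p * (\<Sum>i. a i * d_j i Q p)" for a
    using assms by (simp add: suminf_add[symmetric] summable_d_j suminf_mult summable_mult)
  have 4: "(\<Sum>i. Q p * (a i * d_jbar i P p) + P p * (a i * d_jbar i Q p)) =
      Q p * (\<Sum>i. a i * d_jbar i P p) + P p * (\<Sum>i. a i * d_jbar i Q p)" for a
    using assms by (simp add: suminf_add[symmetric] summable_d_jbar suminf_mult summable_mult)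
  show "e_m1 f (\<lambda>p. P p * Q p) p = e_m1 f P p * Q p + P p * e_m1 f Q p"
    using assms unfolding e_m1_def 1 2 3 4
    by (simp add: d_z_def d_u_def field_simps)
qed

lemma e_m1_sum [simp]:
  "(\<And>j. j \<in> A \<Longrightarrow> jet_diff (P j)) \<Longrightarrow>
     e_m1 f (\<lambda>p. \<Sum>j\<in>A. P j p) = (\<lambda>p. \<Sum>j\<in>A. e_m1 f (P j) p)"
  by (induction A rule: infinite_finite_induct) auto

lemma e_m1_bar_const [simp]: "e_m1_bar f (\<lambda>p. c) = (\<lambda>p. 0)"
  by (simp add: e_m1_bar_def fun_eq_iff)

lemma e_m1_bar_add [simp]:
  "jet_diff P \<Longrightarrow> jet_diff Q \<Longrightarrow>
     e_m1_bar f (\<lambda>p. P p + Q p) = (\<lambda>p. e_m1_bar f P p + e_m1_bar f Q p)"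
  by (simp add: e_m1_bar_def fun_eq_iff)

lemma e_m1_bar_mult [simp]:
  "jet_diff P \<Longrightarrow> jet_diff Q \<Longrightarrow>
     e_m1_bar f (\<lambda>p. P p * Q p) = (\<lambda>p. e_m1_bar f P p * Q p + P p * e_m1_bar f Q p)"
  by (simp add: e_m1_bar_def fun_eq_iff)

lemma e_m1_bar_sum [simp]:
  "(\<And>j. j \<in> A \<Longrightarrow> jet_diff (P j)) \<Longrightarrow>
     e_m1_bar f (\<lambda>p. \<Sum>j\<in>A. P j p) = (\<lambda>p. \<Sum>j\<in>A. e_m1_bar f (P j) p)"
  by (induction A rule: infinite_finite_induct) auto

lemma jet_diff_diff [simp]:
  "jet_diff P \<Longrightarrow> jet_diff Q \<Longrightarrow> jet_diff (\<lambda>p. P p - Q p)"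
  using jet_diff_add[of P "\<lambda>p. - 1 * Q p"] jet_diff_mult[of "\<lambda>p. - 1" Q] by simp

lemma e_m1_diff [simp]:
  assumes "jet_diff P" "jet_diff Q"
  shows "e_m1 f (\<lambda>p. P p - Q p) = (\<lambda>p. e_m1 f P p - e_m1 f Q p)"
  using e_m1_add[of P "\<lambda>p. - 1 * Q p" f] e_m1_mult[of "\<lambda>p. - 1" Q f]
    jet_diff_mult[of "\<lambda>p. - 1" Q] assms by simp

lemma jet_diff_minus [simp]: "jet_diff P \<Longrightarrow> jet_diff (\<lambda>p. - P p)"
  using jet_diff_diff[of "\<lambda>p. 0" P] by simp

lemma e_m1_minus [simp]: "jet_diff P \<Longrightarrow> e_m1 f (\<lambda>p. - P p) = (\<lambda>p. - e_m1 f P p)"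
  using e_m1_diff[of "\<lambda>p. 0" P f] by simp

lemma jet_diff_divide [simp]: "jet_diff P \<Longrightarrow> jet_diff (\<lambda>p. P p / c)"
  using jet_diff_mult[of P "\<lambda>p. 1 / c"] by simp

lemma e_m1_divide [simp]: "jet_diff P \<Longrightarrow> e_m1 f (\<lambda>p. P p / c) = (\<lambda>p. e_m1 f P p / c)"
  using e_m1_mult[of P "\<lambda>p. 1 / c" f] by simp

lemma e_m1_bar_divide [simp]:
  "jet_diff P \<Longrightarrow> e_m1_bar f (\<lambda>p. P p / c) = (\<lambda>p. e_m1_bar f P p / c)"
  by (simp add: e_m1_bar_def fun_eq_iff)

lemma e_m1_bar_diff [simp]:
  assumes "jet_diff P" "jet_diff Q"
  shows "e_m1_bar f (\<lambda>p. P p - Q p) = (\<lambda>p. e_m1_bar f P p - e_m1_bar f Q p)"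
  using assms by (simp add: e_m1_bar_def fun_eq_iff)

section \<open>Action on the coordinates\<close>

lemma e_m1_jcoord [simp]: "e_m1 f (jcoord i) = jcoord (Suc i)"
proof
  fix p
  have "jcoord (Suc k) p * d_j k (jcoord i) p = (if k = i then jcoord (Suc i) p else 0)" for k
    by (simp add: d_j_def)
  moreover have "d_jbar k (jcoord i) p = 0" for k
    by (simp add: d_jbar_def)
  moreover have "(\<Sum>k. if k = i then jcoord (Suc i) p else 0) = jcoord (Suc i) p"
    using sums_single[of i "\<lambda>_. jcoord (Suc i) p"] by (simp add: sums_iff)
  ultimately show "e_m1 f (jcoord i) p = jcoord (Suc i) p"
    by (simp add: e_m1_def d_z_def d_u_def)
qed

text \<open>On the conjugate of \<open>u_i\<close> only the antiholomorphic part of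
  \<open>e_m1\<close> acts, with coefficient \<open>- cnj (T f i)\<close>; the outer conjugation
  turns this into \<open>- T f i\<close>.\<close>

lemma e_m1_bar_jcoord [simp]: "e_m1_bar f (jcoord i) = (\<lambda>p. - T f i p)"
proof
  fix p
  have "cnj (T f k p) * d_jbar k (\<lambda>p. cnj (jcoord i p)) p =
      (if k = i then cnj (T f i p) else 0)" for k
    by (simp add: d_jbar_def)
  moreover have "d_j k (\<lambda>p. cnj (jcoord i p)) p = 0" for k
    by (simp add: d_j_def)
  moreover have "(\<Sum>k. if k = i then cnj (T f i p) else 0) = cnj (T f i p)"
    using sums_single[of i "\<lambda>_. cnj (T f i p)"] by (simp add: sums_iff)
  ultimately show "e_m1_bar f (jcoord i) p = - T f i p"
    by (simp add: e_m1_bar_def e_m1_def d_z_def d_u_def)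
qed

lemma e_m1_ucoord:
  assumes "\<And>x. g differentiable (at x)"
  shows "e_m1 f (\<lambda>p. complex_of_real (g (ucoord p))) =
    (\<lambda>p. jcoord 0 p * of_real (deriv g (ucoord p)))"
  by (simp add: e_m1_def d_z_def d_u_def d_j_def d_jbar_def pd_ucoord[OF assms] fun_eq_iff)


section \<open>Weighted homogeneous polynomials in the jet coordinates\<close>

inductive hpoly :: "nat \<Rightarrow> (jet \<Rightarrow> complex) \<Rightarrow> bool" where
  const: "hpoly 0 (\<lambda>p. c)"
| zero: "hpoly d (\<lambda>p. 0)"
| coord: "hpoly (Suc i) (jcoord i)"
| add: "hpoly d P \<Longrightarrow> hpoly d Q \<Longrightarrow> hpoly d (\<lambda>p. P p + Q p)"
| mult: "hpoly d P \<Longrightarrow> hpoly e Q \<Longrightarrow> hpoly (d + e) (\<lambda>p. P p * Q p)"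

lemma hpoly_mult:
  "hpoly d P \<Longrightarrow> hpoly e Q \<Longrightarrow> n = d + e \<Longrightarrow> hpoly n (\<lambda>p. P p * Q p)"
  by (simp add: hpoly.mult)

lemma hpoly_cmult: "hpoly d P \<Longrightarrow> hpoly d (\<lambda>p. c * P p)"
  using hpoly.mult[OF hpoly.const] by simp

lemma hpoly_sum:
  "(\<And>j. j \<in> A \<Longrightarrow> hpoly d (P j)) \<Longrightarrow> hpoly d (\<lambda>p. \<Sum>j\<in>A. P j p)"
  by (induction A rule: infinite_finite_induct) (auto intro: hpoly.intros)

lemma hpoly_diff:
  "hpoly d P \<Longrightarrow> hpoly d Q \<Longrightarrow> hpoly d (\<lambda>p. P p - Q p)"
  using hpoly.add[OF _ hpoly_cmult[where c = "-1"]] by simp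

lemma jet_diff_hpoly: "hpoly d P \<Longrightarrow> jet_diff P"
  by (induction rule: hpoly.induct) auto

text \<open>\<open>e_m1\<close> maps \<open>u_i\<close> to \<open>u_(i+1)\<close>, raising the
  weight by one, and the product rule carries this to all polynomials.\<close>

lemma hpoly_e_m1: "hpoly d P \<Longrightarrow> hpoly (Suc d) (e_m1 f P)"
proof (induction rule: hpoly.induct)
  case (mult d P e Q)
  have "hpoly (Suc (d + e)) (\<lambda>p. e_m1 f P p * Q p)" "hpoly (Suc (d + e)) (\<lambda>p. P p * e_m1 f Q p)"
    using mult by (simp_all add: hpoly_mult)
  with mult show ?case
    by (simp add: jet_diff_hpoly hpoly.add)
qed (simp_all add: jet_diff_hpoly hpoly.intros)

lemma hpoly_weighted_degree:
  assumes "hpoly d P" shows "weighted_degree P (int d)"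
proof -
  have "P (inverse l * z, u, \<lambda>j. l ^ (j + 1) * w j) = l ^ d * P (z, u, w)"
    for l z :: complex and u w
    using assms
    by (induction rule: hpoly.induct) (simp_all add: jcoord_def power_add algebra_simps)
  then show ?thesis
    unfolding weighted_degree_def power_int_of_nat by blast
qed

lemma hpoly_d_u: "hpoly d P \<Longrightarrow> d_u P = (\<lambda>p. 0)"
  by (induction rule: hpoly.induct) (auto simp: d_u_def jet_diff_hpoly fun_eq_iff)


section \<open>Holomorphic jet functions over the solution space of the ODE\<close>

text \<open>When \<open>f\<^sub>u\<^sub>u = \<beta> f\<close>, the ring generated by the \<open>u\<^sub>i\<close>, \<open>f\<close> and \<open>f\<^sub>u\<close> is closed under all partial
  derivatives and contains the \<open>T\<^sup>i\<close>.\<close>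

inductive_set jet_ring :: "(real \<Rightarrow> real) \<Rightarrow> (jet \<Rightarrow> complex) set" for f where
  const: "(\<lambda>p. c) \<in> jet_ring f"
| coord: "jcoord i \<in> jet_ring f"
| f0: "(\<lambda>p. of_real (f (ucoord p))) \<in> jet_ring f"
| f1: "(\<lambda>p. of_real (deriv f (ucoord p))) \<in> jet_ring f"
| add: "P \<in> jet_ring f \<Longrightarrow> Q \<in> jet_ring f \<Longrightarrow> (\<lambda>p. P p + Q p) \<in> jet_ring f"
| mult: "P \<in> jet_ring f \<Longrightarrow> Q \<in> jet_ring f \<Longrightarrow> (\<lambda>p. P p * Q p) \<in> jet_ring f"

lemma jet_ring_sum:
  "(\<And>j. j \<in> A \<Longrightarrow> P j \<in> jet_ring f) \<Longrightarrow> (\<lambda>p. \<Sum>j\<in>A. P j p) \<in> jet_ring f"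
  by (induction A rule: infinite_finite_induct) (auto intro: jet_ring.intros)

lemma hpoly_jet_ring: "hpoly d P \<Longrightarrow> P \<in> jet_ring f"
  by (induction rule: hpoly.induct) (auto intro: jet_ring.intros)

lemma d_u_eq_pd: "d_u = pd U"
  by (simp add: d_u_def fun_eq_iff)

locale second_order_ode =
  fixes f :: "real \<Rightarrow> real" and \<beta> :: real
  assumes differentiable_f: "\<And>x. f differentiable (at x)"
    and differentiable_f': "\<And>x. deriv f differentiable (at x)"
    and f_uu: "\<And>x. deriv (deriv f) x = \<beta> * f x"
begin

lemma jet_diff_f [simp]:
  "jet_diff (\<lambda>p. of_real (f (ucoord p)))" "jet_diff (\<lambda>p. of_real (deriv f (ucoord p)))"
  by (simp_all add: jet_diff_ucoord differentiable_f differentiable_f')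

lemma pd_f [simp]:
  "pd c (\<lambda>p. of_real (f (ucoord p))) = (\<lambda>p. if c = U then of_real (deriv f (ucoord p)) else 0)"
  "pd c (\<lambda>p. of_real (deriv f (ucoord p))) =
     (\<lambda>p. if c = U then of_real \<beta> * of_real (f (ucoord p)) else 0)"
  using pd_ucoord[of f c] pd_ucoord[of "deriv f" c]
  by (simp_all add: differentiable_f differentiable_f' f_uu cong: if_cong)

lemma e_m1_f [simp]:
  "e_m1 f (\<lambda>p. of_real (f (ucoord p))) = (\<lambda>p. jcoord 0 p * of_real (deriv f (ucoord p)))"
  "e_m1 f (\<lambda>p. of_real (deriv f (ucoord p))) =
     (\<lambda>p. jcoord 0 p * (of_real \<beta> * of_real (f (ucoord p))))"
  using e_m1_ucoord[of f f] e_m1_ucoord[of "deriv f" f]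
  by (simp_all add: differentiable_f differentiable_f' f_uu)

lemma jet_ring_jet_diff: "P \<in> jet_ring f \<Longrightarrow> jet_diff P"
  by (induction rule: jet_ring.induct) auto

lemma jet_ring_pd: "P \<in> jet_ring f \<Longrightarrow> pd c P \<in> jet_ring f"
proof (induction rule: jet_ring.induct)
  case (coord i)
  then show ?case
    by (simp add: jet_ring.const)
qed (cases "c = U"; simp add: jet_ring_jet_diff; intro jet_ring.intros; assumption)+

lemma jet_ring_e_m1: "P \<in> jet_ring f \<Longrightarrow> e_m1 f P \<in> jet_ring f"
  by (induction rule: jet_ring.induct;
      simp add: jet_ring_jet_diff; intro jet_ring.intros; assumption)

section \<open>Smoothness and holomorphy of the ring elements\<close>

lemma continuous_on_ucoord:
  assumes "\<And>x. g differentiable (at x)"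
  shows "continuous_on UNIV (\<lambda>p. g (ucoord p))"
proof -
  have g: "continuous_on UNIV g"
    by (simp add: continuous_at_imp_continuous_on differentiable_imp_continuous_within assms)
  have "continuous_on UNIV ucoord"
    unfolding ucoord_def by (intro continuous_on_fst continuous_on_snd continuous_on_id)
  from continuous_on_compose2[OF g this] show ?thesis
    by simp
qed

lemma continuous_on_jcoord: "continuous_on UNIV (jcoord i)"
proof -
  have "continuous_on UNIV (\<lambda>p :: jet. snd (snd p))"
    by (intro continuous_on_snd continuous_on_id)
  from continuous_on_product_then_coordinatewise[OF this, of i] show ?thesis
    unfolding jcoord_def .
qed

lemma jet_ring_continuous: "P \<in> jet_ring f \<Longrightarrow> continuous_on UNIV P"
  by (induction rule: jet_ring.induct)
    (simp_all add: continuous_on_jcoord continuous_on_ucoord differentiable_f differentiable_f'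
      continuous_on_add continuous_on_mult)

text \<open>The ring is closed under \<open>pd\<close>, so every iterated partial derivative is
  again in it; all members are continuous and differentiable along each coordinate.\<close>

lemma jet_ring_jet_smooth:
  assumes "P \<in> jet_ring f" shows "jet_smooth P"
proof -
  have R: "foldr pd cs P \<in> jet_ring f" for cs
    by (induction cs) (simp_all add: assms jet_ring_pd)
  show ?thesis
    unfolding jet_smooth_def
  proof (intro conjI allI)
    show "finitely_many_coords P"
      using jet_ring_jet_diff[OF assms] by (simp only: jet_diff_def)
    show "continuous_on UNIV (foldr pd cs P)" for cs
      by (rule jet_ring_continuous[OF R])
    show "(\<lambda>t. foldr pd cs P (move c t p)) differentiable (at 0)" for cs c p
      using jet_ring_jet_diff[OF R, of cs] unfolding jet_diff_def by (elim conjE allE)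
  qed
qed

lemma jet_ring_d_j:
  assumes "P \<in> jet_ring f" shows "d_j i P \<in> jet_ring f"
proof -
  have "d_j i P = (\<lambda>p. 1/2 * pd (ReJ i) P p + (- \<i>/2) * pd (ImJ i) P p)"
    by (rule ext) (simp add: d_j_def diff_divide_distrib)
  moreover have "\<dots> \<in> jet_ring f"
    by (intro jet_ring.add jet_ring.mult jet_ring.const jet_ring_pd assms)
  ultimately show ?thesis
    by (simp only:)
qed

text \<open>\<open>d_jbar i\<close> is a derivation that kills all generators. Applied to
  \<open>d_j i P\<close>, which stays in the ring, this yields the mixed-derivative condition in
  \<open>V\<close>.\<close>

lemma jet_ring_d_jbar: "P \<in> jet_ring f \<Longrightarrow> d_jbar i P p = 0"
proof (induction rule: jet_ring.induct)
  case (add P Q)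
  then have "pd (ReJ i) P p + \<i> * pd (ImJ i) P p = 0" "pd (ReJ i) Q p + \<i> * pd (ImJ i) Q p = 0"
    by (simp_all add: d_jbar_def)
  then have "(pd (ReJ i) P p + pd (ReJ i) Q p) + \<i> * (pd (ImJ i) P p + pd (ImJ i) Q p) = 0"
    by algebra
  then show ?case
    using add by (simp add: d_jbar_def jet_ring_jet_diff)
next
  case (mult P Q)
  then have "pd (ReJ i) P p + \<i> * pd (ImJ i) P p = 0" "pd (ReJ i) Q p + \<i> * pd (ImJ i) Q p = 0"
    by (simp_all add: d_jbar_def)
  then have "(P p * pd (ReJ i) Q p + pd (ReJ i) P p * Q p) +
      \<i> * (P p * pd (ImJ i) Q p + pd (ImJ i) P p * Q p) = 0"
    by algebra
  then show ?case
    using mult by (simp add: d_jbar_def jet_ring_jet_diff)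
qed (simp_all add: d_jbar_def)

text \<open>The coefficients of \<open>e_m1\<close> that depend on \<open>u\<close> stand only at
  the antiholomorphic derivatives, which vanish on the ring. The remaining coefficients 1 and
  \<open>u_j\<close> are independent of \<open>u\<close>.\<close>

lemma e_m1_pd_U: "P \<in> jet_ring f \<Longrightarrow> e_m1 f (pd U P) = pd U (e_m1 f P)"
  by (induction rule: jet_ring.induct)
    (auto simp: jet_ring_jet_diff jet_ring_pd jet_ring_e_m1 algebra_simps)

section \<open>The functions \<open>T f i\<close> and the commutator\<close>

lemma jet_ring_T: "T f i \<in> jet_ring f"
proof (induction i rule: less_induct)
  case (less i)
  then show ?case
    by (cases i) (auto simp: d_u_eq_pd less_Suc_eq_le
        intro!: jet_ring.intros jet_ring_sum jet_ring_pd)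
qed

lemma jet_diff_T [simp]: "jet_diff (T f i)" "jet_diff (pd U (T f i))"
  by (simp_all add: jet_ring_jet_diff jet_ring_T jet_ring_pd)

text \<open>This makes the commutator of the vector field and its conjugate vanish on the \<open>u\<^sub>i\<close>.\<close>

lemma e_m1_T: "e_m1 f (T f i) = T f (Suc i)"
proof (induction i rule: less_induct)
  case (less i)
  show ?case
  proof (cases i)
    case 0
    then show ?thesis
      by (simp add: d_u_eq_pd)
  next
    case (Suc k)
    \<comment> \<open>The recursion involves the \<open>u\<close>-derivatives of the
      \<open>T f j\<close>, so the induction hypothesis is first moved past
      \<open>pd U\<close>.\<close>
    have d_T: "e_m1 f (pd U (T f j)) = pd U (T f (Suc j))" if "j \<le> k" for j
      using that less Suc by (simp add: e_m1_pd_U jet_ring_T del: T.simps)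
    show ?thesis
    proof
      fix p
      define a where "a j = pd U (T f j) p" for j
      have "e_m1 f (T f i) p = (\<Sum>j\<le>k. of_nat (k choose j) *
          (jcoord (Suc k - j) p * a j + jcoord (k - j) p * a (Suc j)))"
        using d_T by (auto simp: Suc d_u_eq_pd a_def algebra_simps atLeast0AtMost Suc_diff_le
           simp del: T.simps(2) simp: T.simps(2)[of f k] intro!: sum.cong)
      \<comment> \<open>Pascal's rule, as in the Leibniz formula: the terms with
        \<open>a (Suc j)\<close> are shifted by one index.\<close>
      also have "\<dots> = (\<Sum>j\<le>Suc k. of_nat (Suc k choose j) * (jcoord (Suc k - j) p * a j))"
      proof -
        have "(\<Sum>j\<le>Suc k. of_nat (Suc k choose j) * (jcoord (Suc k - j) p * a j)) =
          jcoord (Suc k) p * a 0 +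
          (\<Sum>j\<le>k. of_nat (k choose Suc j) * (jcoord (k - j) p * a (Suc j))) +
          (\<Sum>j\<le>k. of_nat (k choose j) * (jcoord (k - j) p * a (Suc j)))"
          by (subst sum.atMost_Suc_shift) (simp add: sum.distrib algebra_simps)
        \<comment> \<open>The sum can be extended to \<open>Suc k\<close> because the binomial
          coefficient \<open>k choose Suc k\<close> is zero.\<close>
        also have "jcoord (Suc k) p * a 0 +
          (\<Sum>j\<le>k. of_nat (k choose Suc j) * (jcoord (k - j) p * a (Suc j))) =
          (\<Sum>j\<le>Suc k. of_nat (k choose j) * (jcoord (Suc k - j) p * a j))"
          by (subst sum.atMost_Suc_shift) simp
        finally show ?thesis
          by (simp add: sum.distrib algebra_simps)
      qed
      also have "\<dots> = T f (Suc i) p"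
        by (simp add: Suc d_u_eq_pd a_def atLeast0AtMost mult.assoc del: sum.atMost_Suc)
      finally show "e_m1 f (T f i) p = T f (Suc i) p" .
    qed
  qed
qed

text \<open>The conjugate field replaces \<open>u_i\<close> by \<open>- T f i\<close>, which leads
  out of the polynomials but not out of the ring. This allows \<open>e_m1\<close> to be applied to
  the result.\<close>

lemma jet_ring_e_m1_bar: "hpoly d P \<Longrightarrow> e_m1_bar f P \<in> jet_ring f"
proof (induction rule: hpoly.induct)
  case (coord i)
  show ?case
    using jet_ring.mult[OF jet_ring.const[of "-1"] jet_ring_T[of i]] by simp
next
  case (mult d P e Q)
  moreover have "P \<in> jet_ring f" "Q \<in> jet_ring f"
    using mult.hyps by (simp_all only: hpoly_jet_ring)
  ultimately show ?case
    by (simp add: jet_diff_hpoly jet_ring.add jet_ring.mult)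
qed (simp_all add: jet_diff_hpoly jet_ring.const jet_ring.add)

text \<open>A commutator of derivations obeys the product rule, so it is enough to check the
  coordinates: there both sides equal \<open>- T f (Suc i)\<close> by \<open>e_m1_T\<close>.\<close>

lemma e_m1_bar_e_m1: "hpoly d P \<Longrightarrow> e_m1_bar f (e_m1 f P) = e_m1 f (e_m1_bar f P)"
proof (induction rule: hpoly.induct)
  case (coord i)
  show ?case
    using e_m1_diff[of "\<lambda>p. 0" "T f i" f] by (simp add: e_m1_T del: T.simps e_m1_diff)
next
  case (mult d P e Q)
  have "jet_diff (e_m1 f P)" "jet_diff (e_m1 f Q)"
    "jet_diff (e_m1_bar f P)" "jet_diff (e_m1_bar f Q)" "jet_diff P" "jet_diff Q"
    using mult by (meson hpoly_e_m1 jet_diff_hpoly jet_ring_e_m1_bar jet_ring_jet_diff)+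
  with mult show ?case
    by (simp add: algebra_simps)
next
  case (add d P Q)
  have "jet_diff (e_m1 f P)" "jet_diff (e_m1 f Q)"
    "jet_diff (e_m1_bar f P)" "jet_diff (e_m1_bar f Q)" "jet_diff P" "jet_diff Q"
    using add by (meson hpoly_e_m1 jet_diff_hpoly jet_ring_e_m1_bar jet_ring_jet_diff)+
  with add show ?case
    by simp
qed auto

end


section \<open>The recursion\<close>

lemma hpoly_Pseq_Suc:
  assumes "i \<ge> 1" "hpoly (2 * i - 1) (Pseq f \<beta> i)" "hpoly (2 * i) (phi f \<beta> i)"
  shows "hpoly (2 * i + 1) (Pseq f \<beta> (i + 1))"
proof -
  have "hpoly (2 * i + 1) (e_m1 f (e_m1 f (Pseq f \<beta> i)))"
    using hpoly_e_m1[OF hpoly_e_m1[OF assms(2)], of f f] assms(1) by simp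
  moreover have "hpoly (2 * i + 1) (\<lambda>p. of_real \<beta> / 2 * jcoord 0 p * phi f \<beta> i p)"
    by (rule hpoly_mult[OF hpoly_cmult[OF hpoly.coord] assms(3)]) simp
  ultimately show ?thesis
    unfolding Pseq_Suc[OF assms(1)] by (rule hpoly_diff)
qed

lemma hpoly_theta:
  assumes "l \<ge> 1" "hpoly (2 * l - 1) (Pseq f \<beta> l)" "hpoly (2 * l) (phi f \<beta> l)"
    and "m \<ge> 1" "hpoly (2 * m - 1) (Pseq f \<beta> m)" "hpoly (2 * m) (phi f \<beta> m)"
  shows "hpoly (2 * (l + m)) (theta f \<beta> l m)"
proof -
  have "hpoly (2 * (l + m)) (\<lambda>p. Pseq f \<beta> l p * Pseq f \<beta> (m + 1) p)"
    using assms by (intro hpoly_mult[OF assms(2) hpoly_Pseq_Suc]) auto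
  moreover have "hpoly (2 * (l + m)) (\<lambda>p. e_m1 f (Pseq f \<beta> l) p * e_m1 f (Pseq f \<beta> m) p)"
    using assms by (intro hpoly_mult[OF hpoly_e_m1 hpoly_e_m1]) auto
  moreover have "hpoly (2 * (l + m)) (\<lambda>p. of_real \<beta> / 4 * phi f \<beta> l p * phi f \<beta> m p)"
    using assms by (intro hpoly_mult[OF hpoly_cmult]) auto
  ultimately show ?thesis
    unfolding theta_eq[OF assms(1,4)] by (intro hpoly.add hpoly_diff)
qed

lemma hpoly_Pseq_phi:
  "i \<ge> 1 \<Longrightarrow> hpoly (2 * i - 1) (Pseq f \<beta> i) \<and> hpoly (2 * i) (phi f \<beta> i)"
proof (induction i rule: less_induct)
  case (less i)
  \<comment> \<open>The index \<open>i\<close> itself must be included: \<open>phi\<close> at 1 and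
    2 contains \<open>Pseq\<close> at the same index.\<close>
  have P: "hpoly (2 * k - 1) (Pseq f \<beta> k)" if "1 \<le> k" "k \<le> i" for k
  proof (cases "k = 1")
    case True
    then show ?thesis
      using hpoly.coord[of 0] Pseq_1[of f \<beta>] by simp
  next
    case False
    define j where "j = k - 1"
    with False that have j: "k = j + 1" "j \<ge> 1" "j < i" by auto
    show ?thesis
      using hpoly_Pseq_Suc[of j f \<beta>] less.IH[of j] j by simp
  qed
  have theta: "hpoly (2 * i) (theta f \<beta> j (i - j))" if "1 \<le> j" "j < i" for j
    using hpoly_theta[of j f \<beta> "i - j"] less.IH[of j] less.IH[of "i - j"] that by simp
  have sum: "hpoly (2 * i) (\<lambda>p. 2 * (\<Sum>j\<in>{1..l - 1}. theta f \<beta> j (i - j) p))"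
    if "l \<le> i" for l
    using that by (intro hpoly_cmult hpoly_sum theta) auto
  show ?case
  proof (cases "odd i")
    case True
    then obtain k where "i = 2 * k + 1"
      by (elim oddE)
    then obtain l where l: "l \<ge> 1" "i = 2 * l - 1"
      using that[of "k + 1"] by auto
    have "hpoly (2 * i) (\<lambda>p. (Pseq f \<beta> l p)\<^sup>2)"
      using l unfolding power2_eq_square by (intro hpoly_mult[OF P P]) auto
    then show ?thesis
      using P[of i] less.prems l sum[of l] unfolding phi_odd[OF l] by (auto intro!: hpoly.add)
  next
    case False
    then obtain l where l: "i = 2 * l" by auto
    with less.prems have l1: "l \<ge> 1" by simp
    \<comment> \<open>Here \<open>l + 1\<close> is at most \<open>2 * l = i\<close>, so the claim
      for \<open>Pseq\<close> covers both factors.\<close>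
    have "hpoly (2 * i) (\<lambda>p. Pseq f \<beta> (l + 1) p * Pseq f \<beta> l p)"
      using l l1 by (intro hpoly_mult[OF P P]) auto
    moreover have "hpoly (2 * i) (theta f \<beta> l l)"
      using theta[of l] l l1 by simp
    ultimately show ?thesis
      using P[of i] less.prems l l1 sum[of l] unfolding phi_even[OF l1 l]
      by (auto intro!: hpoly.add)
  qed
qed

lemma
  assumes "i \<ge> 1"
  shows jet_diff_Pseq: "jet_diff (Pseq f \<beta> i)"
    and jet_diff_e_m1_Pseq: "jet_diff (e_m1 f (Pseq f \<beta> i))"
    and jet_diff_phi: "jet_diff (phi f \<beta> i)"
  using hpoly_Pseq_phi[OF assms] by (blast intro: jet_diff_hpoly hpoly_e_m1)+

lemma jet_diff_theta:
  assumes "l \<ge> 1" "m \<ge> 1" shows "jet_diff (theta f \<beta> l m)"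
  using assms hpoly_Pseq_phi by (blast intro: jet_diff_hpoly hpoly_theta)

lemma sum_telescope_from_1:
  fixes a :: "nat \<Rightarrow> complex"
  assumes "l \<ge> 1" shows "(\<Sum>j\<in>{1..l - 1}. a j - a (j + 1)) = a 1 - a l"
proof -
  have "(\<Sum>j\<in>{1..k}. a j - a (j + 1)) = a 1 - a (k + 1)" for k
    by (induction k) auto
  from this[of "l - 1"] assms show ?thesis
    by simp
qed

context second_order_ode
begin

section \<open>The three identities by simultaneous induction\<close>

definition phi_e_m1 :: "nat \<Rightarrow> bool" where
  "phi_e_m1 i \<longleftrightarrow> (\<forall>p. e_m1 f (phi f \<beta> i) p = 2 * jcoord 0 p * e_m1 f (Pseq f \<beta> i) p)"

definition phi_e_m1_bar :: "nat \<Rightarrow> bool" where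
  "phi_e_m1_bar i \<longleftrightarrow>
     (\<forall>p. e_m1_bar f (phi f \<beta> i) p = - 2 * of_real (f (ucoord p)) * Pseq f \<beta> i p)"

definition Pseq_wave :: "nat \<Rightarrow> bool" where
  "Pseq_wave i \<longleftrightarrow> (\<forall>p. e_m1_bar f (e_m1 f (Pseq f \<beta> i)) p =
     - of_real (deriv f (ucoord p)) * Pseq f \<beta> i p)"

lemma e_m1_e_m1_Pseq:
  assumes "i \<ge> 1"
  shows "e_m1 f (e_m1 f (Pseq f \<beta> i)) p =
    Pseq f \<beta> (i + 1) p + of_real \<beta> / 2 * jcoord 0 p * phi f \<beta> i p"
  unfolding Pseq_Suc[OF assms] by simp

text \<open>Commuting the fields on \<open>e_m1 f (Pseq f \<beta> i)\<close> and differentiating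
  \<open>- f_u P^i\<close> gives a term \<open>- \<beta> u_0 f P^i\<close>. It cancels against the
  derivative of \<open>phi\<close> in the correction \<open>- (\<beta>/2) u_0 phi^i\<close>.\<close>

lemma e_m1_bar_Pseq_Suc:
  assumes "i \<ge> 1" "phi_e_m1_bar i" "Pseq_wave i"
  shows "e_m1_bar f (Pseq f \<beta> (i + 1)) =
    (\<lambda>p. of_real \<beta> / 2 * of_real (f (ucoord p)) * phi f \<beta> i p
       - of_real (deriv f (ucoord p)) * e_m1 f (Pseq f \<beta> i) p)"
proof
  fix p
  have hP: "hpoly (Suc (2 * i - 1)) (e_m1 f (Pseq f \<beta> i))"
    using hpoly_Pseq_phi[OF assms(1)] by (blast intro: hpoly_e_m1)
  have d: "jet_diff (e_m1 f (e_m1 f (Pseq f \<beta> i)))"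
    using hpoly_e_m1[OF hP] by (rule jet_diff_hpoly)
  have w: "e_m1_bar f (e_m1 f (Pseq f \<beta> i)) =
      (\<lambda>p. - of_real (deriv f (ucoord p)) * Pseq f \<beta> i p)"
    using assms(3) by (auto simp: Pseq_wave_def)
  have "e_m1_bar f (e_m1 f (e_m1 f (Pseq f \<beta> i))) p =
      - (of_real \<beta> * jcoord 0 p * of_real (f (ucoord p)) * Pseq f \<beta> i p)
      - of_real (deriv f (ucoord p)) * e_m1 f (Pseq f \<beta> i) p"
    unfolding e_m1_bar_e_m1[OF hP] w
    using assms(1) by (simp add: jet_diff_Pseq algebra_simps)
  then show "e_m1_bar f (Pseq f \<beta> (i + 1)) p =
      of_real \<beta> / 2 * of_real (f (ucoord p)) * phi f \<beta> i p
       - of_real (deriv f (ucoord p)) * e_m1 f (Pseq f \<beta> i) p"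
    using assms(1,2) d unfolding Pseq_Suc[OF assms(1)]
    by (simp add: jet_diff_phi phi_e_m1_bar_def del: split_paired_All) (simp add: field_simps)
qed

text \<open>\<open>e_m1\<close> maps \<open>u_0\<close> to \<open>u_1\<close>, which the conjugate
  field maps to \<open>- T f 1 = - u_0 f_u\<close>.\<close>

lemma Pseq_wave_1: "Pseq_wave 1"
  unfolding Pseq_wave_def Pseq_1 by (simp add: d_u_eq_pd del: split_paired_All)

text \<open>Apply \<open>e_m1\<close> to \<open>(\<beta>/2) f phi^i - f_u e_m1(P^i)\<close>. The
  terms with \<open>\<beta> u_0 f e_m1(P^i)\<close> cancel, and the rest is \<open>- f_u\<close>
  times the recursion for \<open>P^(i+1)\<close>.\<close>

lemma Pseq_wave_Suc:
  assumes "i \<ge> 1" "phi_e_m1 i" "phi_e_m1_bar i" "Pseq_wave i"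
  shows "Pseq_wave (i + 1)"
  unfolding Pseq_wave_def
proof
  fix p
  have h: "hpoly (2 * (i + 1) - 1) (Pseq f \<beta> (i + 1))"
    using hpoly_Pseq_phi[of "i + 1"] by simp
  show "e_m1_bar f (e_m1 f (Pseq f \<beta> (i + 1))) p =
      - of_real (deriv f (ucoord p)) * Pseq f \<beta> (i + 1) p"
    unfolding e_m1_bar_e_m1[OF h] e_m1_bar_Pseq_Suc[OF assms(1,3,4)]
    using assms(1,2)
    by (simp add: jet_diff_phi jet_diff_e_m1_Pseq e_m1_e_m1_Pseq phi_e_m1_def
        del: split_paired_All) (simp add: field_simps)
qed

text \<open>Second derivatives of \<open>Pseq\<close> are replaced through the recursion. The
  resulting products of \<open>u_0\<close>, \<open>phi\<close> and a first derivative are cancelled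
  by the term \<open>(\<beta>/4) phi^l phi^m\<close>, which explains its coefficient.\<close>

lemma e_m1_theta:
  assumes "l \<ge> 1" "phi_e_m1 l" "m \<ge> 1" "phi_e_m1 m"
  shows "e_m1 f (theta f \<beta> l m) p =
    Pseq f \<beta> l p * e_m1 f (Pseq f \<beta> (m + 1)) p - Pseq f \<beta> (l + 1) p * e_m1 f (Pseq f \<beta> m) p"
  using assms
  by (simp add: theta_eq jet_diff_Pseq jet_diff_e_m1_Pseq jet_diff_phi phi_e_m1_def
      e_m1_e_m1_Pseq del: split_paired_All) (simp add: field_simps)

text \<open>With \<open>e_m1_bar_Pseq_Suc\<close> at \<open>m\<close>, all terms containing
  \<open>P^l\<close> undifferentiated cancel; the terms containing \<open>P^m\<close> combine to the
  same formula at \<open>l\<close>.\<close>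

lemma e_m1_bar_theta:
  assumes "l \<ge> 1" "phi_e_m1_bar l" "Pseq_wave l" "m \<ge> 1" "phi_e_m1_bar m" "Pseq_wave m"
  shows "e_m1_bar f (theta f \<beta> l m) p =
    e_m1_bar f (Pseq f \<beta> l) p * Pseq f \<beta> (m + 1) p
      - e_m1_bar f (Pseq f \<beta> (l + 1)) p * Pseq f \<beta> m p"
  using assms e_m1_bar_Pseq_Suc[of l] e_m1_bar_Pseq_Suc[of m]
  by (simp add: theta_eq jet_diff_Pseq jet_diff_e_m1_Pseq jet_diff_phi phi_e_m1_bar_def
      Pseq_wave_def del: split_paired_All) (simp add: field_simps)

text \<open>Here \<open>D\<close> stands for both vector fields, with \<open>X j = P\<^sup>j\<close> and \<open>Y j = e\<^sub>-\<^sub>1 P\<^sup>j\<close>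
  for the first one and the roles of \<open>X\<close> and \<open>Y\<close> exchanged for its conjugate; the sum of the
  \<open>\<theta>\<^sup>j\<^sup>,\<^sup>i\<^sup>-\<^sup>j\<close> telescopes after differentiation.\<close>

lemma derivation_phi:
  fixes D :: "(jet \<Rightarrow> complex) \<Rightarrow> jet \<Rightarrow> complex" and X Y :: "nat \<Rightarrow> complex"
  assumes i: "i \<ge> 1"
    and D_add: "\<And>P Q. jet_diff P \<Longrightarrow> jet_diff Q \<Longrightarrow> D (\<lambda>p. P p + Q p) = (\<lambda>p. D P p + D Q p)"
    and D_sum: "\<And>(P :: nat \<Rightarrow> jet \<Rightarrow> complex) A. (\<And>j. j \<in> A \<Longrightarrow> jet_diff (P j)) \<Longrightarrow>
      D (\<lambda>p. \<Sum>j\<in>A. P j p) = (\<lambda>p. \<Sum>j\<in>A. D (P j) p)"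
    and D_Pseq: "\<And>j k. j \<ge> 1 \<Longrightarrow> k \<ge> 1 \<Longrightarrow>
      D (\<lambda>p. Pseq f \<beta> j p * Pseq f \<beta> k p) p = X j * Y k + X k * Y j"
    and D_theta: "\<And>l m. 1 \<le> l \<Longrightarrow> l < i \<Longrightarrow> 1 \<le> m \<Longrightarrow> m < i \<Longrightarrow>
      D (theta f \<beta> l m) p = X l * Y (m + 1) - X (l + 1) * Y m"
  shows "D (phi f \<beta> i) p = 2 * X 1 * Y i"
proof -
  have D_sum_theta: "D (\<lambda>p. 2 * (\<Sum>j\<in>{1..l - 1}. theta f \<beta> j (i - j) p)) p =
      2 * (X 1 * Y i - X l * Y (i + 1 - l))" if "l \<ge> 1" "l \<le> i" for l
  proof -
    have "D (\<lambda>p. \<Sum>j\<in>{1..l - 1}. theta f \<beta> j (i - j) p) p =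
        (\<Sum>j\<in>{1..l - 1}. D (theta f \<beta> j (i - j)) p)"
      using that by (subst D_sum) (auto intro!: jet_diff_theta)
    also have "\<dots> = (\<Sum>j\<in>{1..l - 1}. X j * Y (i + 1 - j) - X (j + 1) * Y (i + 1 - (j + 1)))"
      using that by (intro sum.cong) (auto simp: D_theta Suc_diff_le)
    also have "\<dots> = X 1 * Y i - X l * Y (i + 1 - l)"
      using sum_telescope_from_1[OF that(1), of "\<lambda>j. X j * Y (i + 1 - j)"] by simp
    finally show ?thesis
      using that unfolding mult_2 by (subst D_add) (auto intro!: jet_diff_sum jet_diff_theta)
  qed
  have diff_sum: "jet_diff (\<lambda>p. 2 * (\<Sum>j\<in>{1..l - 1}. theta f \<beta> j (i - j) p))"
    if "l \<le> i" for l
    using that by (intro jet_diff_mult jet_diff_const jet_diff_sum jet_diff_theta) auto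
  have diff_Pseq: "jet_diff (\<lambda>p. Pseq f \<beta> j p * Pseq f \<beta> k p)" if "j \<ge> 1" "k \<ge> 1" for j k
    using that by (simp add: jet_diff_Pseq)
  show ?thesis
  proof (cases "odd i")
    case True
    then obtain k where "i = 2 * k + 1"
      by (elim oddE)
    then obtain l where l: "l \<ge> 1" "i = 2 * l - 1"
      using that[of "k + 1"] by auto
    \<comment> \<open>The telescoped sum leaves \<open>- 2 * X l * Y l\<close>, which the derivative
      of the square cancels.\<close>
    have "i + 1 - l = l" "l \<le> i"
      using l by auto
    then show ?thesis
      unfolding phi_odd[OF l] power2_eq_square
        D_add[OF diff_Pseq[OF l(1) l(1)] diff_sum[OF \<open>l \<le> i\<close>]]
      using l(1) D_sum_theta[of l] by (simp only: D_Pseq) (simp add: algebra_simps)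
  next
    case False
    then obtain l where l: "i = 2 * l" by auto
    with i have l1: "l \<ge> 1" by simp
    \<comment> \<open>The sum now leaves \<open>- 2 * X l * Y (l + 1)\<close>. The product
      contributes \<open>X (l + 1) * Y l + X l * Y (l + 1)\<close> and the diagonal
      \<open>theta\<close> contributes \<open>X l * Y (l + 1) - X (l + 1) * Y l\<close>, which
      together cancel it.\<close>
    have "i + 1 - l = l + 1" "l \<le> i" and l2: "l + 1 \<ge> 1"
      using l by auto
    then show ?thesis
      unfolding phi_even[OF l1 l]
        D_add[OF jet_diff_add[OF diff_Pseq[OF l2 l1] jet_diff_theta[OF l1 l1]]
          diff_sum[OF \<open>l \<le> i\<close>]]
        D_add[OF diff_Pseq[OF l2 l1] jet_diff_theta[OF l1 l1]]
      using l1 l2 D_sum_theta[of l] D_theta[of l l] l by (simp only: D_Pseq) (simp add: algebra_simps)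
  qed
qed

lemma phi_Pseq_derivatives:
  "i \<ge> 1 \<Longrightarrow> phi_e_m1 i \<and> phi_e_m1_bar i \<and> Pseq_wave i"
proof (induction i rule: less_induct)
  case (less i)
  have wave: "Pseq_wave i"
    using Pseq_wave_1 Pseq_wave_Suc[of "i - 1"] less by (cases "i = 1") auto
  have "phi_e_m1 i"
    unfolding phi_e_m1_def
  proof
    fix p
    \<comment> \<open>\<open>derivation_phi\<close> asks for the derivative of \<open>theta\<close>
      only at indices below \<open>i\<close>, where the induction hypothesis applies.\<close>
    have "e_m1 f (phi f \<beta> i) p = 2 * Pseq f \<beta> 1 p * e_m1 f (Pseq f \<beta> i) p"
      using less
      by (intro derivation_phi[where X = "\<lambda>j. Pseq f \<beta> j p" and Y = "\<lambda>j. e_m1 f (Pseq f \<beta> j) p"])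
        (auto simp: jet_diff_Pseq e_m1_theta simp del: split_paired_All)
    then show "e_m1 f (phi f \<beta> i) p = 2 * jcoord 0 p * e_m1 f (Pseq f \<beta> i) p"
      by (simp only: Pseq_1)
  qed
  moreover have "phi_e_m1_bar i"
    unfolding phi_e_m1_bar_def
  proof
    fix p
    have "e_m1_bar f (phi f \<beta> i) p = 2 * e_m1_bar f (Pseq f \<beta> 1) p * Pseq f \<beta> i p"
      using less
      by (intro derivation_phi[where X = "\<lambda>j. e_m1_bar f (Pseq f \<beta> j) p"
            and Y = "\<lambda>j. Pseq f \<beta> j p"])
        (auto simp: jet_diff_Pseq e_m1_bar_theta simp del: split_paired_All)
    then show "e_m1_bar f (phi f \<beta> i) p = - 2 * of_real (f (ucoord p)) * Pseq f \<beta> i p"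
      by (simp only: Pseq_1 e_m1_bar_jcoord T.simps) simp
  qed
  ultimately show ?case
    using wave by simp
qed

text \<open>Polynomiality gives the weight and independence of \<open>u\<close>, ring membership
  gives smoothness and the vanishing mixed derivatives, and \<open>Pseq_wave\<close> is the
  differential equation.\<close>

lemma Pseq_in_V:
  assumes "i \<ge> 1" shows "Pseq f \<beta> i \<in> V f (2 * int i - 1)"
proof -
  have h: "hpoly (2 * i - 1) (Pseq f \<beta> i)"
    using hpoly_Pseq_phi[OF assms] by simp
  then have R: "Pseq f \<beta> i \<in> jet_ring f"
    by (rule hpoly_jet_ring)
  have "weighted_degree (Pseq f \<beta> i) (2 * int i - 1)"
    using hpoly_weighted_degree[OF h] assms by (simp add: of_nat_diff)
  moreover have "e_m1_bar f (e_m1 f (Pseq f \<beta> i)) p +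
      of_real (deriv f (ucoord p)) * Pseq f \<beta> i p = 0" for p
    using phi_Pseq_derivatives[OF assms] by (simp add: Pseq_wave_def del: split_paired_All)
  ultimately show ?thesis
    unfolding V_def mem_Collect_eq
    by (intro conjI allI jet_ring_jet_smooth[OF R] jet_ring_d_jbar[OF jet_ring_d_j[OF R]])
      (simp_all add: hpoly_d_u[OF h])
qed

end

theorem lemma9p2:
  fixes f :: "real \<Rightarrow> real" and \<beta> :: real
  assumes f_smooth: "\<forall>n x. (deriv ^^ n) f differentiable (at x)"
    and f_uu: "\<forall>x. deriv (deriv f) x = \<beta> * f x"
    and \<beta>_nonzero: "\<beta> \<noteq> 0"
  shows "\<forall>i\<ge>1.
      (\<forall>p. e_m1 f (phi f \<beta> i) p = 2 * jcoord 0 p * e_m1 f (Pseq f \<beta> i) p) \<and>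
      (\<forall>p. e_m1_bar f (phi f \<beta> i) p = - 2 * of_real (f (ucoord p)) * Pseq f \<beta> i p) \<and>
      (\<forall>p. e_m1_bar f (e_m1 f (Pseq f \<beta> i)) p = - of_real (deriv f (ucoord p)) * Pseq f \<beta> i p) \<and>
      Pseq f \<beta> i \<in> V f (2 * int i - 1)"
proof -
  interpret second_order_ode f \<beta>
    using f_smooth[rule_format, of 0] f_smooth[rule_format, of 1] f_uu by unfold_locales auto
  show ?thesis
    using phi_Pseq_derivatives Pseq_in_V
    unfolding phi_e_m1_def phi_e_m1_bar_def Pseq_wave_def by blast
qed

end
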